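(* Let $X$ be an uncountable separable metric space with metric $d$. Let $k>0$ and $c>0$ be integers, and let $\chi: [X]^k \rightarrow \{1,2,\dots,c\}$ be a coloring of the $k$-element subsets of $X$ with $c$ colors. Then there exist an infinite subset $\Lambda \subseteq X$ that is monochromatic for $\chi$, and a point $r \in \Lambda$, such that for every $\epsilon > 0$ there exists $r_{\epsilon} \in \Lambda$ with $r_\epsilon \neq r$ and $d(r_{\epsilon}, r) < \epsilon$.
   Context: For a set $A$, $[A]^k$ denotes the set of $k$-element subsets of $A$. A subset $\Lambda \subseteq X$ is monochromatic for $\chi$ if $\chi$ takes the same value on all $k$-element subsets of $\Lambda$. The Axiom of Choice is assumed. *)

theory Defs
  imports "HOL-Analysis.Analysis" "HOL-Library.Ramsey"
begin

end

theory Submission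
  imports Defs
begin

text \<open>
  Let a countable \<open>K \<subseteq> X\<close> be closed under a Skolem function that, for every finite \<open>F \<subseteq> K\<close>, supplies
  points arbitrarily close to any point \<open>r \<notin> F\<close> and indistinguishable from \<open>r\<close> by the colors of the sets
  \<open>insert r s\<close> with \<open>s \<subseteq> F\<close>, \<open>card s = k - 1\<close>. Choose \<open>r \<in> X - K\<close>. Then one can pick a sequence
  in \<open>K\<close> converging to \<open>r\<close> such that replacing the last point of any \<open>k\<close>-set of the sequence by
  \<open>r\<close> preserves its color. Apply Ramsey's theorem to the coloring \<open>s \<mapsto> col (insert r s)\<close> of
  the \<open>(k - 1)\<close>-sets of this sequence, and add \<open>r\<close> to the homogeneous set.
\<close>

lemma (in Metric_space) separable_spaceE:
  assumes "separable_space mtopology"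
  obtains D where "countable D" "D \<subseteq> M" "\<And>x e. x \<in> M \<Longrightarrow> e > 0 \<Longrightarrow> \<exists>q\<in>D. d x q < e"
proof -
  obtain D where D: "countable D" "D \<subseteq> M" "mtopology closure_of D = M"
    using assms by (auto simp: separable_space_def)
  have "\<exists>q\<in>D. d x q < e" if "x \<in> M" "e > 0" for x e
  proof -
    have "x \<in> mtopology closure_of D" using D that by simp
    then show ?thesis using that by (auto simp: metric_closure_of)
  qed
  with D that show ?thesis by blast
qed

text \<open>Fix a countable dense \<open>D\<close>. There are only countably many triples of a value
  of \<open>f\<close>, a center \<open>q\<close> in \<open>D\<close> and a radius 1/(n+1); choose
  one point of \<open>A\<close> for each triple that some point of \<open>A\<close> realizes. Any
  \<open>r\<close> in \<open>A\<close> realizes a triple of radius below \<open>e/2\<close>, and the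
  point chosen for it shares with \<open>r\<close> both the value of \<open>f\<close> and the
  center, so it is within \<open>e\<close> of \<open>r\<close>.\<close>

lemma (in Metric_space) countable_fiberwise_dense:
  assumes sep: "separable_space mtopology" and A: "A \<subseteq> M" and cnt: "countable (f ` A)"
  obtains C where "countable C" "C \<subseteq> A"
    "\<And>r e. r \<in> A \<Longrightarrow> e > 0 \<Longrightarrow> \<exists>a\<in>C. f a = f r \<and> d a r < e"
proof -
  obtain D where D: "countable D" "D \<subseteq> M" "\<And>x e. x \<in> M \<Longrightarrow> e > 0 \<Longrightarrow> \<exists>q\<in>D. d x q < e"
    using separable_spaceE[OF sep] by metis
  define P where "P = (\<lambda>(t,q,n::nat) x. x \<in> A \<and> f x = t \<and> d x q < 1 / Suc n)"
  define I where "I = {i \<in> (f ` A) \<times> D \<times> UNIV. \<exists>x. P i x}"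
  define g where "g i = (SOME x. P i x)" for i
  have g: "P i (g i)" if "i \<in> I" for i
    using that unfolding g_def I_def by (auto intro: someI)
  show ?thesis
  proof
    have "countable (f ` A \<times> D \<times> (UNIV :: nat set))"
      by (intro countable_SIGMA cnt D(1)) simp
    then show "countable (g ` I)"
      unfolding I_def by (intro countable_image countable_subset[OF Collect_restrict])
    show "g ` I \<subseteq> A" using g by (fastforce simp: P_def)
  next
    fix r and e :: real assume r: "r \<in> A" and e: "e > 0"
    then obtain n where n: "1 / Suc n < e / 2"
      using nat_approx_posE[of "e/2"] by auto
    obtain q where q: "q \<in> D" "d r q < 1 / Suc n"
      using D(3)[of r "1 / Suc n"] r A by auto
    let ?i = "(f r, q, n)"
    have "P ?i r" using r q by (simp add: P_def)
    then have i: "?i \<in> I" using r q by (auto simp: I_def)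
    then have gi: "g ?i \<in> A" "f (g ?i) = f r" "d (g ?i) q < 1 / Suc n"
      using g[OF i] by (auto simp: P_def)
    have "d (g ?i) r \<le> d (g ?i) q + d q r"
      using gi(1) r q A D(2) by (intro triangle) auto
    also have "\<dots> < e" using gi(3) q(2) n commute[of q r] by linarith
    finally show "\<exists>a\<in>g ` I. f a = f r \<and> d a r < e" using i gi by blast
  qed
qed

text \<open>Start from the empty set and adjoin all \<open>C F\<close> for finite \<open>F\<close>
  in the current stage, \<omega> many times. Each stage stays countable, since a countable set has
  countably many finite subsets. The stages increase, so a finite subset of their union already lies
  in one of them, and the next stage contains its \<open>C F\<close>.\<close>

lemma countable_closed_under_finite_subsets:
  fixes C :: "'a set \<Rightarrow> 'a set"
  assumes C: "\<And>F. finite F \<Longrightarrow> F \<subseteq> X \<Longrightarrow> countable (C F) \<and> C F \<subseteq> X"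
  obtains K where "countable K" "K \<subseteq> X" "\<And>F. finite F \<Longrightarrow> F \<subseteq> K \<Longrightarrow> C F \<subseteq> K"
proof -
  define step where "step M = M \<union> (\<Union>F\<in>{F. finite F \<and> F \<subseteq> M}. C F)" for M
  define K where "K n = (step ^^ n) {}" for n
  have K: "countable (K n) \<and> K n \<subseteq> X" for n
  proof (induction n)
    case (Suc n)
    have "countable (C F) \<and> C F \<subseteq> X" if "F \<in> {F. finite F \<and> F \<subseteq> K n}" for F
      using that Suc by (intro C) auto
    moreover have "countable {F. finite F \<and> F \<subseteq> K n}"
      using Suc countable_Collect_finite_subset by blast
    ultimately have "countable (step (K n)) \<and> step (K n) \<subseteq> X"
      unfolding step_def using Suc by (intro conjI countable_Un countable_UN) auto
    then show ?case by (simp add: K_def)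
  qed (simp add: K_def)
  have Suc: "K (Suc n) = step (K n)" for n by (simp add: K_def)
  have mono: "mono K"
    by (rule incseq_SucI) (auto simp: Suc step_def)
  show ?thesis
  proof
    show "countable (\<Union>n. K n)" "(\<Union>n. K n) \<subseteq> X" using K by auto
    fix F assume F: "finite F" "F \<subseteq> (\<Union>n. K n)"
    have "\<exists>n. F \<subseteq> K n" using F
    proof induction
      case (insert x F)
      then obtain m n where "x \<in> K m" "F \<subseteq> K n" by auto
      then have "insert x F \<subseteq> K (max m n)"
        using monoD[OF mono, of m "max m n"] monoD[OF mono, of n "max m n"] by auto
      then show ?case ..
    qed simp
    then obtain n where "F \<subseteq> K n" ..
    then have "C F \<subseteq> K (Suc n)" using F by (auto simp: Suc step_def)
    then show "C F \<subseteq> (\<Union>n. K n)" by blast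
  qed
qed

text \<open>Ramsey's theorem handles the \<open>k\<close>-sets that contain \<open>r\<close>. In a
  \<open>k\<close>-set without \<open>r\<close>, trading its last point for \<open>r\<close> keeps
  the color by \<open>eh\<close>, which reduces to the first case.\<close>

lemma end_homogeneous_imp_homogeneous:
  fixes a :: "nat \<Rightarrow> 'a"
  assumes inj: "inj a" and r: "r \<notin> range a" and k: "k > 0"
    and eh: "\<And>n s. s \<in> [a ` {..<n}]\<^bsup>(k - 1)\<^esup> \<Longrightarrow> col (insert (a n) s) = col (insert r s)"
    and bound: "\<And>s. s \<in> [range a]\<^bsup>(k - 1)\<^esup> \<Longrightarrow> col (insert r s) \<le> (c::nat)"
  obtains J where "infinite J" "col constant_on [insert r (a ` J)]\<^bsup>k\<^esup>"
proof -
  have "infinite (range a)" using inj finite_imageD by blast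
  \<comment> \<open>\<open>Suc c\<close> colors, because \<open>bound\<close> puts the values in 0,
    ..., \<open>c\<close>.\<close>
  then obtain Y t where Y: "Y \<subseteq> range a" "infinite Y"
    and t: "(\<lambda>s. col (insert r s)) ` [Y]\<^bsup>(k - 1)\<^esup> \<subseteq> {t}"
    by (rule Ramsey_nsets[of "range a" "\<lambda>s. col (insert r s)" "k - 1" "Suc c"])
      (use bound in \<open>auto simp: less_Suc_eq_le\<close>)
  have t: "col (insert r s) = t" if "s \<subseteq> Y" "finite s" "card s = k - 1" for s
    using t that by (auto simp: nsets_def)
  obtain J where J: "Y = a ` J" using Y(1) by (auto simp: subset_image_iff)
  show ?thesis
  proof
    show "infinite J" using Y J by auto
    have "col s = t" if s: "s \<in> [insert r Y]\<^bsup>k\<^esup>" for s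
    proof (cases "r \<in> s")
      case True
      then have "s - {r} \<subseteq> Y" "finite (s - {r})" "card (s - {r}) = k - 1"
        using s by (auto simp: nsets_def)
      then show ?thesis using t[of "s - {r}"] True by (simp add: insert_absorb)
    next
      case False
      then have sY: "s \<subseteq> a ` J" "finite s" "card s = k" using s J by (auto simp: nsets_def)
      then obtain I where I: "I \<subseteq> J" "s = a ` I" by (auto simp: subset_image_iff)
      have fI: "finite I" using sY I inj by (metis finite_imageD inj_on_subset subset_UNIV)
      have "I \<noteq> {}" using sY I k by auto
      \<comment> \<open>\<open>a n\<close> is the last point of \<open>s\<close>; the remaining
        \<open>k - 1\<close> points have smaller indices, as \<open>eh\<close> demands.\<close>
      define n where "n = Max I"
      have n: "n \<in> I" and le: "\<And>i. i \<in> I \<Longrightarrow> i \<le> n"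
        using fI \<open>I \<noteq> {}\<close> by (auto simp: n_def)
      have "s - {a n} \<subseteq> a ` {..<n}"
      proof
        fix x assume "x \<in> s - {a n}"
        then obtain i where "x = a i" "i \<in> I" "i \<noteq> n" using I by auto
        then show "x \<in> a ` {..<n}" using le[of i] by auto
      qed
      moreover have *: "s - {a n} \<subseteq> Y" "finite (s - {a n})" "card (s - {a n}) = k - 1"
        using sY I n J by auto
      ultimately have "col (insert (a n) (s - {a n})) = col (insert r (s - {a n}))"
        by (intro eh) (auto simp: nsets_def)
      moreover have "insert (a n) (s - {a n}) = s" using n I by auto
      ultimately show ?thesis using t[OF *] by simp
    qed
    then show "col constant_on [insert r (a ` J)]\<^bsup>k\<^esup>"
      unfolding constant_on_def J by blast
  qed
qed

theorem theorem2p1: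
  fixes X :: "'a set" and d :: "'a \<Rightarrow> 'a \<Rightarrow> real"
    and k c :: nat and col :: "'a set \<Rightarrow> nat"
  assumes "Metric_space X d"
    and "separable_space (Metric_space.mtopology X d)"
    and "uncountable X"
    and "k > 0" and "c > 0"
    and "col \<in> [X]\<^bsup>k\<^esup> \<rightarrow> {1..c}"
  shows "\<exists>\<Lambda>. \<Lambda> \<subseteq> X \<and> infinite \<Lambda> \<and> col constant_on [\<Lambda>]\<^bsup>k\<^esup> \<and>
    (\<exists>r\<in>\<Lambda>. \<forall>\<epsilon>>0. \<exists>r\<^sub>\<epsilon>\<in>\<Lambda>. r\<^sub>\<epsilon> \<noteq> r \<and> d r\<^sub>\<epsilon> r < \<epsilon>)"
proof -
  interpret Metric_space X d by fact
  \<comment> \<open>\<open>f F x\<close> is the color pattern of \<open>x\<close> over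
    \<open>F\<close>. The restriction makes it extensional, so that for finite \<open>F\<close> the
    patterns of points outside \<open>F\<close> form a finite set.\<close>
  define f where "f F x = restrict (\<lambda>s. col (insert x s)) ([F]\<^bsup>(k - 1)\<^esup>)" for F x
  have ins: "insert x s \<in> [X]\<^bsup>k\<^esup>" if "x \<in> X" "s \<in> [F]\<^bsup>(k - 1)\<^esup>" "x \<notin> F" "F \<subseteq> X" for x s F
  proof -
    have "s \<subseteq> F" "finite s" "card s = k - 1" using that by (auto simp: nsets_def)
    moreover from this have "x \<notin> s" using that by auto
    ultimately show ?thesis using that \<open>k > 0\<close> by (auto simp: nsets_def)
  qed
  have "\<exists>C. countable C \<and> C \<subseteq> X - F \<and>
      (\<forall>r\<in>X - F. \<forall>e>0. \<exists>a\<in>C. f F a = f F r \<and> d a r < e)"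
    if F: "finite F" "F \<subseteq> X" for F
  proof -
    have "f F ` (X - F) \<subseteq> [F]\<^bsup>(k - 1)\<^esup> \<rightarrow>\<^sub>E {1..c}"
      using ins[OF _ _ _ F(2)] assms(6) by (auto simp: f_def Pi_iff simp del: atLeastAtMost_iff)
    moreover have "finite ([F]\<^bsup>(k - 1)\<^esup> \<rightarrow>\<^sub>E {1..c})"
      using F by (intro finite_PiE finite_imp_finite_nsets) auto
    ultimately have "countable (f F ` (X - F))"
      by (meson countable_finite finite_subset)
    from assms(2) Diff_subset this obtain C where "countable C" "C \<subseteq> X - F"
        "\<And>r e. r \<in> X - F \<Longrightarrow> e > 0 \<Longrightarrow> \<exists>a\<in>C. f F a = f F r \<and> d a r < e"
      by (rule countable_fiberwise_dense) blast
    then show ?thesis by (intro exI[of _ C]) auto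
  qed
  then obtain C where C: "\<And>F. finite F \<Longrightarrow> F \<subseteq> X \<Longrightarrow> countable (C F) \<and> C F \<subseteq> X - F \<and>
      (\<forall>r\<in>X - F. \<forall>e>0. \<exists>a\<in>C F. f F a = f F r \<and> d a r < e)"
    by metis
  have CX: "countable (C F) \<and> C F \<subseteq> X" if "finite F" "F \<subseteq> X" for F
    using C[OF that] by blast
  obtain K where K: "countable K" "K \<subseteq> X" "\<And>F. finite F \<Longrightarrow> F \<subseteq> K \<Longrightarrow> C F \<subseteq> K"
    by (rule countable_closed_under_finite_subsets[of X C, OF CX]) blast+
  \<comment> \<open>Since \<open>r\<close> avoids all of \<open>K\<close>, the closure property can
    be applied to \<open>r\<close> over every finite subset of \<open>K\<close>.\<close>
  have "\<not> X \<subseteq> K"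
    using countable_subset[OF _ K(1)] assms(3) by auto
  then obtain r where r: "r \<in> X" "r \<notin> K"
    by auto
  \<comment> \<open>The three conditions yield, in turn, injectivity of the sequence inside
    \<open>K\<close>, the color exchange with \<open>r\<close>, and convergence to \<open>r\<close>.
    Only the values of \<open>a\<close> below \<open>n\<close> matter, which allows a recursive
    choice.\<close>
  define P where "P a n x \<longleftrightarrow> x \<in> K - a ` {..<n} \<and> f (a ` {..<n}) x = f (a ` {..<n}) r \<and>
      d x r < 1 / Suc n" for a n x
  have "\<exists>a. \<forall>n. P a n (a n)"
  proof (rule dependent_wellorder_choice)
    fix x n and a b :: "nat \<Rightarrow> 'a"
    assume "\<And>m. m < n \<Longrightarrow> a m = b m"
    then have "a ` {..<n} = b ` {..<n}" by auto
    then show "P a n x = P b n x" by (simp add: P_def)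
  next
    fix n and a :: "nat \<Rightarrow> 'a"
    assume "\<And>m. m < n \<Longrightarrow> P a m (a m)"
    then have F: "a ` {..<n} \<subseteq> K" by (auto simp: P_def)
    with K(2) r have "a ` {..<n} \<subseteq> X" "r \<in> X - a ` {..<n}" by blast+
    moreover have "(0::real) < 1 / Suc n" by simp
    ultimately have "\<exists>x\<in>C (a ` {..<n}). f (a ` {..<n}) x = f (a ` {..<n}) r \<and> d x r < 1 / Suc n"
      using C[of "a ` {..<n}"] by (meson finite_imageI finite_lessThan)
    \<comment> \<open>Closure of \<open>K\<close> keeps the new point in \<open>K\<close>; that
      \<open>C F\<close> avoids \<open>F\<close> makes it differ from the earlier ones.\<close>
    moreover have "C (a ` {..<n}) \<subseteq> K - a ` {..<n}"
      using C[of "a ` {..<n}"] K(3)[of "a ` {..<n}"] F \<open>a ` {..<n} \<subseteq> X\<close> by auto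
    ultimately show "\<exists>x. P a n x"
      unfolding P_def by (meson subsetD)
  qed
  then obtain a where a: "\<And>n. P a n (a n)" by blast
  have aK: "range a \<subseteq> K" using a by (auto simp: P_def)
  have "a m \<noteq> a n" if "m < n" for m n
    using a[of n] that unfolding P_def by (metis DiffD2 imageI lessThan_iff)
  then have inj: "inj a" by (metis injI nat_neq_iff)
  have eh: "col (insert (a n) s) = col (insert r s)" if "s \<in> [a ` {..<n}]\<^bsup>(k - 1)\<^esup>" for n s
  proof -
    have "f (a ` {..<n}) (a n) s = f (a ` {..<n}) r s" using a[of n] by (simp add: P_def)
    then show ?thesis using that by (simp add: f_def)
  qed
  have rA: "r \<notin> range a" using aK r by blast
  have bound: "col (insert r s) \<le> c" if "s \<in> [range a]\<^bsup>(k - 1)\<^esup>" for s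
    using ins[of r s "range a"] that r aK K(2) assms(6) by (auto simp: Pi_iff)
  then obtain J where J: "infinite J" "col constant_on [insert r (a ` J)]\<^bsup>k\<^esup>"
    using end_homogeneous_imp_homogeneous[OF inj rA \<open>k > 0\<close> eh bound] by blast
  have "\<exists>x\<in>insert r (a ` J). x \<noteq> r \<and> d x r < e" if e: "e > 0" for e
  proof -
    obtain m where m: "1 / Suc m < e" using nat_approx_posE[OF e] by auto
    \<comment> \<open>An infinite \<open>J\<close> has members beyond any \<open>m\<close>, so the
      subsequence indexed by \<open>J\<close> still converges to \<open>r\<close>.\<close>
    obtain n where n: "n \<in> J" "m \<le> n" using J(1) by (metis infinite_nat_iff_unbounded_le)
    have "d (a n) r < 1 / Suc n" using a[of n] by (simp add: P_def)
    also have "\<dots> \<le> 1 / Suc m" using n by (simp add: field_simps)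
    finally have "d (a n) r < e" using m by simp
    moreover have "a n \<noteq> r" using aK r by auto
    ultimately show ?thesis using n by blast
  qed
  moreover have "infinite (insert r (a ` J))"
    using J(1) inj by (simp add: finite_image_iff inj_on_subset)
  ultimately show ?thesis
    using J r aK K(2) by (intro exI[of _ "insert r (a ` J)"]) auto
qed

end
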